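(* Let $\varepsilon>0$ and $f\in C^2(\mathbb{R})$, and consider the boundary value problem $$\left(\frac{\varepsilon v_x}{1+\varepsilon^2v_x^2}\right)_x=f(v)_x,\quad x\in(-\ell,\ell),\qquad v(\pm\ell)=u_\pm,$$ for some $u_->u_+$. Let $m=\min_{u\in[u_+,u_-]}f(u)$ and $M=\max_{u\in[u_+,u_-]}f(u)$. (i) There exists a unique (smooth) decreasing solution satisfying $$-\varepsilon^{-1}<v_x(x)<0\qquad\forall x\in(-\ell,\ell)$$ if and only if $$M-m<\frac12\qquad\text{and}\qquad\frac{2\ell}{\varepsilon}>B,$$ where $$B:=\int_{u_+}^{u_-}\frac{1+2\sqrt{(f(s)-m)\left(1-(f(s)-m)\right)}}{1-2(f(s)-m)}\,ds.$$ (ii) Moreover, there exists a unique (smooth) decreasing solution satisfying $$v_x(x)<-\varepsilon^{-1}\qquad\forall x\in(-\ell,\ell)$$ if and only if $$M-m<\frac12\qquad\text{and}\qquad L_-<\frac{2\ell}{\varepsilon}<L_+,$$ where $$L_-:=\int_{u_+}^{u_-}\frac{2(M-f(s))}{1+\sqrt{1-4(f(s)-M)^2}}\,ds,\qquad L_+:=\int_{u_+}^{u_-}\frac{1-2(f(s)-m)}{1+2\sqrt{(f(s)-m)\left(1-(f(s)-m)\right)}}\,ds.$$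
   Context: Here $\ell>0$ is given and $u_\pm\in\mathbb{R}$ are the prescribed boundary values. Solutions $v=v(x)$ of the boundary value problem are the stationary solutions of the conservation law with nonlinear diffusion $u_t+f(u)_x=Q(\varepsilon u_x)_x$ on $(-\ell,\ell)$ with Dirichlet data $u(\pm\ell,t)=u_\pm$, where $Q(s)=\frac{s}{1+s^2}$. The subscript $x$ denotes differentiation in $x$.
   Formalization: In both equivalences the slope bounds hold on [-ℓ,ℓ] (one-sided at ±ℓ): with bounds only on (-ℓ,ℓ), "only if" fails when 2ℓ/ε=B or L₊ (e.g. f=u², u₊=0, u₋=1/2, ε=1). "If", with uniqueness, is also given for the open interval. "Smooth" means C² on [-ℓ,ℓ]. *)

theory Defs
  imports "HOL-Analysis.Analysis"
begin

definition Q :: "real \<Rightarrow> real" where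
  "Q s = s / (1 + s\<^sup>2)"

(* Derivatives are taken within S, so that they are one-sided at the endpoints
   when S is a compact interval. *)
definition C1_on :: "real set \<Rightarrow> (real \<Rightarrow> real) \<Rightarrow> bool" where
  "C1_on S g \<longleftrightarrow>
     (\<forall>x\<in>S. g differentiable (at x within S)) \<and>
     continuous_on S (\<lambda>x. vector_derivative g (at x within S))"

definition C2_on :: "real set \<Rightarrow> (real \<Rightarrow> real) \<Rightarrow> bool" where
  "C2_on S g \<longleftrightarrow> C1_on S g \<and> C1_on S (\<lambda>x. vector_derivative g (at x within S))"

definition dx :: "real \<Rightarrow> (real \<Rightarrow> real) \<Rightarrow> real \<Rightarrow> real" where
  "dx l g x = vector_derivative g (at x within {-l..l})"

(* Classical decreasing solutions; here um, up stand for the boundary values u_-, u_+.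
   The functions live on [-l, l] only: membership in extensional fixes the irrelevant
   values elsewhere, so that unique existence means uniqueness on [-l, l].
   C2_on guarantees that all derivatives in the equation exist. *)
definition decreasing_solution ::
  "real \<Rightarrow> real \<Rightarrow> (real \<Rightarrow> real) \<Rightarrow> real \<Rightarrow> real \<Rightarrow> (real \<Rightarrow> real) \<Rightarrow> bool" where
  "decreasing_solution \<epsilon> l f um up v \<longleftrightarrow>
     v \<in> extensional {-l..l} \<and>
     C2_on {-l..l} v \<and>
     (\<forall>x\<in>{-l<..<l}. dx l (\<lambda>y. Q (\<epsilon> * dx l v y)) x = dx l (\<lambda>y. f (v y)) x) \<and>
     v (-l) = um \<and> v l = up \<and>
     strict_antimono_on {-l..l} v"

(* The integrands below are continuous whenever M - m < 1/2, the only case in which the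
   integrals are used. *)
definition B_int :: "(real \<Rightarrow> real) \<Rightarrow> real \<Rightarrow> real \<Rightarrow> real \<Rightarrow> real" where
  "B_int f m um up = integral {up..um}
     (\<lambda>s. (1 + 2 * sqrt ((f s - m) * (1 - (f s - m)))) / (1 - 2 * (f s - m)))"

definition L_minus :: "(real \<Rightarrow> real) \<Rightarrow> real \<Rightarrow> real \<Rightarrow> real \<Rightarrow> real" where
  "L_minus f M um up = integral {up..um}
     (\<lambda>s. 2 * (M - f s) / (1 + sqrt (1 - 4 * (f s - M)\<^sup>2)))"

definition L_plus :: "(real \<Rightarrow> real) \<Rightarrow> real \<Rightarrow> real \<Rightarrow> real \<Rightarrow> real" where
  "L_plus f m um up = integral {up..um}
     (\<lambda>s. (1 - 2 * (f s - m)) / (1 + 2 * sqrt ((f s - m) * (1 - (f s - m)))))"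

(* On the slope bounds.  If they are imposed on the open interval (-l, l) only, the
   necessity of the strict conditions 2l/\<epsilon> > B and 2l/\<epsilon> < L_+ fails: for f(u) = u^2,
   u_+ = 0, u_- = 1/2, \<epsilon> = 1, 2l = B, the solution of
   v' = -(1 - 2 v^2) / (1 + 2 v sqrt (1 - v^2)), v(-l) = 1/2, is smooth on [-l, l], satisfies
   v(l) = 0 and -1 < v' < 0 on (-l, l), and v'(l) = -1; taking the reciprocal of the right-hand
   side gives the analogous example with 2l = L_+.  The equivalences are therefore stated with
   the bounds holding up to the boundary (J = {-l..l}), while sufficiency, including
   uniqueness, is also stated with the bounds on J = {-l<..<l}. *)
definition small_slope :: "real \<Rightarrow> real \<Rightarrow> real set \<Rightarrow> (real \<Rightarrow> real) \<Rightarrow> bool" where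
  "small_slope \<epsilon> l J v \<longleftrightarrow> (\<forall>x\<in>J. - (1 / \<epsilon>) < dx l v x \<and> dx l v x < 0)"

definition large_slope :: "real \<Rightarrow> real \<Rightarrow> real set \<Rightarrow> (real \<Rightarrow> real) \<Rightarrow> bool" where
  "large_slope \<epsilon> l J v \<longleftrightarrow> (\<forall>x\<in>J. dx l v x < - (1 / \<epsilon>))"

end

theory Submission
  imports Defs
begin

text \<open>
  Write \<open>p = - \<epsilon> v'\<close>. Since \<open>Q\<close> is odd, the equation integrates once to
  \<open>Q p = K - f(v)\<close> with a constant \<open>K\<close>. On \<open>p \<ge> 0\<close> the function \<open>Q\<close> climbs from \<open>0\<close> to its
  maximum \<open>1/2\<close> at \<open>p = 1\<close> and then decays, and \<open>Q (1/p) = Q p\<close>; so with \<open>q\<close> denoting the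
  inverse of \<open>Q\<close> on \<open>[0, 1]\<close>, a slope in \<open>(-1/\<epsilon>, 0)\<close> means \<open>p = q(K - f(v))\<close>, and a slope below
  \<open>-1/\<epsilon>\<close> means \<open>p = 1 / q(K - f(v))\<close>. As \<open>v\<close> runs through all of \<open>[u\<^sub>+, u\<^sub>-]\<close>, the strict slope
  bounds on the closed interval force \<open>0 < K - f < 1/2\<close> there, that is \<open>M < K < m + 1/2\<close>; this is
  where \<open>M - m < 1/2\<close> comes from.

  What remains is a separable autonomous equation, which can be solved for \<open>x\<close> as a function of
  \<open>v\<close>. The boundary conditions hold exactly when the travel time from \<open>u\<^sub>-\<close> to \<open>u\<^sub>+\<close> is
  \<open>2 l / \<epsilon>\<close>, and \<open>v\<close> is then determined by \<open>K\<close>. The travel time is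
  \<open>T K = \<integral> 1 / q(K - f)\<close> on the slow branch and \<open>S K = \<integral> q(K - f)\<close> on the fast one. Because \<open>q\<close>
  is increasing, both are strictly monotone and continuous in \<open>K\<close>, so that the problem is to find
  their ranges over \<open>M < K < m + 1/2\<close>. The explicit formula for \<open>q\<close> shows \<open>T (m + 1/2) = B\<close>,
  \<open>S (m + 1/2) = L\<^sub>+\<close> and \<open>S M = L\<^sub>-\<close>. As \<open>K\<close> decreases to \<open>M\<close>, the slow time tends to infinity:
  near a point \<open>s\<^sub>0\<close> where \<open>f\<close> attains \<open>M\<close> the function \<open>f\<close> is Lipschitz, hence
  \<open>q(K - f(s)) \<le> 2 (K - M + C \<bar>s - s\<^sub>0\<bar>)\<close>, and the integral grows like a logarithm
  (\<open>slow_time_unbounded\<close>). The ranges are therefore \<open>(B, \<infinity>)\<close> and \<open>(L\<^sub>-, L\<^sub>+)\<close>.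

  If the slope bounds are imposed on the open interval only, \<open>K\<close> could also be an end point of its
  range. The value \<open>K = m + 1/2\<close> would make \<open>2 l / \<epsilon>\<close> equal to \<open>B\<close> or \<open>L\<^sub>+\<close>. On the fast branch
  \<open>K = M\<close> is impossible because the slope is finite and nonzero, so that \<open>Q p > 0\<close>. On the slow
  branch a solution with \<open>K = M\<close> would be at least as slow as every one with \<open>K > M\<close>, and would
  need infinite time.
\<close>

section \<open>The branches of the inverse of the diffusion function\<close>

text \<open>The smaller root \<open>p\<close> of the quadratic equation \<open>y p\<^sup>2 - p + y = 0\<close>, with its numerator
  rationalised so that the formula stays meaningful at \<open>y = 0\<close>.\<close>

definition Q_inv :: "real \<Rightarrow> real" where
  "Q_inv y = 2 * y / (1 + sqrt (1 - 4 * y\<^sup>2))"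

lemma one_minus_four_square_nonneg: "0 \<le> 1 - 4 * y\<^sup>2" if "\<bar>y\<bar> \<le> 1/2" for y :: real
proof -
  have "\<bar>y\<bar>\<^sup>2 \<le> (1/2)\<^sup>2" using that by (intro power_mono) auto
  then show ?thesis by (simp add: power2_eq_square)
qed

lemma Q_Q_inv: "Q (Q_inv y) = y" if "\<bar>y\<bar> \<le> 1/2"
proof -
  define w where "w = sqrt (1 - 4 * y\<^sup>2)"
  have w: "0 \<le> w" "w\<^sup>2 = 1 - 4 * y\<^sup>2"
    using one_minus_four_square_nonneg[OF that] by (auto simp: w_def)
  have "1 + (2 * y / (1 + w))\<^sup>2 = ((1 + w)\<^sup>2 + 4 * y\<^sup>2) / (1 + w)\<^sup>2"
    using w(1) by (simp add: field_simps power2_eq_square add_nonneg_eq_0_iff)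
  also have "(1 + w)\<^sup>2 + 4 * y\<^sup>2 = 2 * (1 + w)"
    using w(2) by (simp add: power2_eq_square algebra_simps)
  also have "2 * (1 + w) / (1 + w)\<^sup>2 = 2 / (1 + w)"
    using w(1) by (simp add: power2_eq_square del: distrib_left_numeral)
  finally have "1 + (Q_inv y)\<^sup>2 = 2 / (1 + w)"
    by (simp add: Q_inv_def w_def)
  then show ?thesis
    using w(1) by (simp add: Q_def Q_inv_def flip: w_def)
qed

text \<open>This symmetry exchanges \<open>(0, 1)\<close> and \<open>(1, \<infinity>)\<close>, so one function \<open>Q_inv\<close> describes both
  branches of the inverse.\<close>

lemma Q_inverse: "Q (1 / p) = Q p"
proof (cases "p = 0")
  case False
  then have "1 + p\<^sup>2 \<noteq> 0" "1 + (1/p)\<^sup>2 \<noteq> 0"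
    by (metis add_less_same_cancel1 not_one_less_zero sum_power2_ge_zero one_power2 zero_neq_one sum_power2_eq_zero_iff)+
  with False show ?thesis
    by (simp add: Q_def field_simps power2_eq_square)
qed (simp add: Q_def)

lemma Q_bounds: "0 \<le> Q p \<and> Q p \<le> 1/2" if "0 \<le> p" for p
proof -
  have "0 < 1 + p\<^sup>2" by (simp add: add_pos_nonneg)
  moreover have "0 \<le> (1 - p)\<^sup>2" by simp
  ultimately show ?thesis
    using that by (simp add: Q_def field_simps power2_eq_square)
qed

lemma Q_pos: "0 < Q p" if "0 < p" for p
  using that by (simp add: Q_def add_pos_nonneg)

lemma Q_less_half: "Q p < 1/2" if "p \<noteq> 1" for p
proof -
  have "0 < 1 + p\<^sup>2" by (simp add: add_pos_nonneg)
  moreover have "0 < (1 - p)\<^sup>2" using that by simp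
  ultimately show ?thesis
    by (simp add: Q_def field_simps power2_eq_square)
qed

lemma Q_inv_Q: "Q_inv (Q p) = p" if "0 \<le> p" "p \<le> 1"
proof -
  have pos: "0 < 1 + p\<^sup>2" by (simp add: add_pos_nonneg)
  have "1 - 4 * (Q p)\<^sup>2 = ((1 - p\<^sup>2) / (1 + p\<^sup>2))\<^sup>2"
    using pos by (simp add: Q_def power_divide field_simps) (simp add: power2_eq_square algebra_simps)
  moreover have "0 \<le> (1 - p\<^sup>2) / (1 + p\<^sup>2)"
    using that pos by (simp add: power_le_one)
  ultimately have "sqrt (1 - 4 * (Q p)\<^sup>2) = (1 - p\<^sup>2) / (1 + p\<^sup>2)"
    by (intro real_sqrt_unique) simp_all
  then have "1 + sqrt (1 - 4 * (Q p)\<^sup>2) = 2 / (1 + p\<^sup>2)"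
    using pos by (simp add: field_simps)
  then show ?thesis
    using pos by (simp add: Q_inv_def Q_def)
qed

lemma Q_inv_Q_ge1: "Q_inv (Q p) = 1 / p" if "1 \<le> p"
  using Q_inv_Q[of "1 / p"] Q_inverse[of p] that by simp

lemma Q_inv_strict_mono: "Q_inv y < Q_inv z" if "0 \<le> y" "y < z" "z \<le> 1/2"
proof -
  have "y\<^sup>2 \<le> z\<^sup>2" using that by (intro power_mono) auto
  moreover have "0 \<le> 1 - 4 * z\<^sup>2" using that by (intro one_minus_four_square_nonneg) auto
  ultimately show ?thesis
    unfolding Q_inv_def using that by (intro frac_less) (auto intro: add_pos_nonneg)
qed

lemma Q_inv_mono: "Q_inv y \<le> Q_inv z" if "0 \<le> y" "y \<le> z" "z \<le> 1/2"
  using Q_inv_strict_mono[of y z] that by (cases "y = z") auto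

lemma Q_inv_0: "Q_inv 0 = 0" and Q_inv_half: "Q_inv (1/2) = 1"
  by (auto simp: Q_inv_def power2_eq_square)

lemma Q_inv_pos: "0 < Q_inv y" if "0 < y" "y \<le> 1/2"
  using Q_inv_strict_mono[of 0 y] that by (simp add: Q_inv_0)

lemma Q_inv_less_1: "Q_inv y < 1" if "0 \<le> y" "y < 1/2"
  using Q_inv_strict_mono[of y "1/2"] that by (simp add: Q_inv_half)

lemma Q_inv_le_double: "Q_inv y \<le> 2 * y" if "0 \<le> y" "y \<le> 1/2"
proof -
  have "0 \<le> sqrt (1 - 4 * y\<^sup>2)"
    using that one_minus_four_square_nonneg[of y] by simp
  then have "2 * y / (1 + sqrt (1 - 4 * y\<^sup>2)) \<le> 2 * y / 1"
    using that by (intro divide_left_mono) (simp_all add: add_pos_nonneg del: real_sqrt_ge_0_iff)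
  then show ?thesis by (simp add: Q_inv_def)
qed

lemma continuous_on_Q_inv: "continuous_on {0..1/2} Q_inv"
proof -
  have "1 + sqrt (1 - 4 * y\<^sup>2) \<noteq> 0" if "y \<in> {0..1/2}" for y :: real
  proof -
    have "0 \<le> sqrt (1 - 4 * y\<^sup>2)"
      using that one_minus_four_square_nonneg[of y] by simp
    then show ?thesis by linarith
  qed
  then show ?thesis
    unfolding Q_inv_def by (intro continuous_intros) auto
qed

lemma Q_inv_C1:
  obtains d where "\<And>y. 0 < y \<Longrightarrow> y < 1/2 \<Longrightarrow> (Q_inv has_real_derivative d y) (at y)"
    and "continuous_on {0<..<1/2} d"
proof
  define w where "w y = sqrt (1 - 4 * y\<^sup>2)" for y :: real
  have pos: "0 < 1 - 4 * y\<^sup>2" "0 < w y" "0 < 1 + w y" if "0 < y" "y < 1/2" for y :: real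
  proof -
    have "y\<^sup>2 < (1/2)\<^sup>2" using that by (intro power_strict_mono) auto
    then show "0 < 1 - 4 * y\<^sup>2" by (simp add: power2_eq_square)
    then show "0 < w y" by (simp add: w_def)
    then show "0 < 1 + w y" by simp
  qed
  show "(Q_inv has_real_derivative (2 * (1 + w y) + 8 * y\<^sup>2 / w y) / (1 + w y)\<^sup>2) (at y)"
    if "0 < y" "y < 1/2" for y
  proof -
    have "(w has_real_derivative - 4 * y / w y) (at y)"
      unfolding w_def using pos[OF that]
      by (auto intro!: derivative_eq_intros simp: field_simps)
    then have "((\<lambda>y. 2 * y / (1 + w y)) has_real_derivative
        (2 * (1 + w y) - 2 * y * (- 4 * y / w y)) / (1 + w y)\<^sup>2) (at y)"
      using pos[OF that]
      by (auto intro!: derivative_eq_intros simp: power2_eq_square)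
    then show ?thesis
      unfolding Q_inv_def w_def by (simp add: power2_eq_square algebra_simps)
  qed
  have "continuous_on {0<..<1/2} w"
    unfolding w_def by (intro continuous_intros)
  then show "continuous_on {0<..<1/2} (\<lambda>y. (2 * (1 + w y) + 8 * y\<^sup>2 / w y) / (1 + w y)\<^sup>2)"
    using pos by (intro continuous_intros) (auto simp: less_imp_neq[symmetric])
qed

section \<open>Travel times of separable equations\<close>

lemma travel_time_derivative:
  assumes "continuous_on {a..b} g"
    and "\<And>x. x \<in> I \<Longrightarrow> v x \<in> {a..b}"
    and "x \<in> I" and "(v has_real_derivative v') (at x within I)"
  shows "((\<lambda>x. integral {a..v x} g) has_real_derivative g (v x) * v') (at x within I)"
proof -
  have "((\<lambda>u. integral {a..u} g) has_real_derivative g (v x)) (at (v x) within v ` I)"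
    using integral_has_real_derivative[OF assms(1)] assms(2,3)
    by (meson DERIV_subset image_subsetI)
  from DERIV_image_chain[OF this assms(4)] show ?thesis
    by (simp add: o_def)
qed

text \<open>The equation \<open>g(v) v' = - 1 / \<epsilon>\<close> says that the primitive of \<open>g\<close>
  decreases at the constant rate \<open>1 / \<epsilon>\<close> along \<open>v\<close>.\<close>

lemma travel_time_eq:
  assumes g: "continuous_on {a..b} g" and "\<epsilon> > 0" "l > 0"
    and v: "\<And>x. x \<in> {-l..l} \<Longrightarrow> v x \<in> {a..b}" "v l = a"
    and ode: "\<And>x. x \<in> {-l..l} \<Longrightarrow> (v has_real_derivative v' x) (at x within {-l..l})"
      "\<And>x. x \<in> {-l..l} \<Longrightarrow> g (v x) * v' x = - 1 / \<epsilon>"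
    and x: "x \<in> {-l..l}"
  shows "integral {a..v x} g = (l - x) / \<epsilon>"
proof -
  let ?F = "\<lambda>x. integral {a..v x} g + x / \<epsilon>"
  have "(?F has_real_derivative 0) (at x within {-l..l})" if "x \<in> {-l..l}" for x
  proof -
    have "(?F has_real_derivative g (v x) * v' x + 1 / \<epsilon>) (at x within {-l..l})"
      by (intro DERIV_add DERIV_cdivide DERIV_ident travel_time_derivative[OF g v(1)] ode that)
    then show ?thesis using ode(2)[OF that] by simp
  qed
  then obtain c where c: "?F x = c" if "x \<in> {-l..l}" for x
    using has_field_derivative_zero_constant[of "{-l..l}" ?F] by auto
  show ?thesis
    using c[OF x] c[of l] \<open>l > 0\<close> \<open>v l = a\<close> by (simp add: diff_divide_distrib)
qed

text \<open>A profile that moves at most as fast as the equation prescribes needs at least the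
  prescribed time. This one-sided form serves to compare a degenerate solution, whose own weight
  is not integrable, with nondegenerate weights.\<close>

lemma travel_time_le:
  assumes g: "continuous_on {a..b} g" and "\<epsilon> > 0" "l > 0"
    and v: "\<And>x. x \<in> {-l..l} \<Longrightarrow> v x \<in> {a..b}" "v l = a" "v (-l) = b"
    and ode: "\<And>x. x \<in> {-l..l} \<Longrightarrow> (v has_real_derivative v' x) (at x within {-l..l})"
      "\<And>x. x \<in> {-l..l} \<Longrightarrow> g (v x) * v' x \<ge> - 1 / \<epsilon>"
  shows "integral {a..b} g \<le> 2 * l / \<epsilon>"
proof -
  let ?F = "\<lambda>x. integral {a..v x} g"
  have "\<exists>x\<in>{-l<..<l}. ?F l - ?F (-l) = (g (v x) * v' x) * (l - (-l))"
    using \<open>l > 0\<close>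
    by (intro mvt_simple[where f' = "\<lambda>x. (*) (g (v x) * v' x)"])
      (auto intro!: travel_time_derivative[OF g v(1)] ode simp flip: has_field_derivative_def)
  then obtain x where x: "x \<in> {-l<..<l}" "?F l - ?F (-l) = (g (v x) * v' x) * (2 * l)"
    by auto
  have "(- 1 / \<epsilon>) * (2 * l) \<le> (g (v x) * v' x) * (2 * l)"
    using ode(2)[of x] x(1) \<open>l > 0\<close> by (intro mult_right_mono) auto
  then show ?thesis using x(2) v by simp
qed

lemma integral_upper_strict_mono:
  fixes g :: "real \<Rightarrow> real"
  assumes g: "continuous_on {a..b} g" "\<And>s. s \<in> {a..b} \<Longrightarrow> g s > 0"
    and "c \<in> {a..b}" "d \<in> {a..b}" "c < d"
  shows "integral {a..c} g < integral {a..d} g"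
proof -
  have sub: "{c..d} \<subseteq> {a..b}" "{a..d} \<subseteq> {a..b}" using assms by auto
  have "integral {c..d} (\<lambda>_. 0) < integral {c..d} g"
    using assms sub by (intro integral_less_real) (auto intro: continuous_on_subset)
  moreover have "integral {a..c} g + integral {c..d} g = integral {a..d} g"
    using assms(3-5) continuous_on_subset[OF g(1) sub(2)]
    by (intro Henstock_Kurzweil_Integration.integral_combine integrable_continuous_real) auto
  ultimately show ?thesis by simp
qed

text \<open>The profile is the inverse function of the primitive \<open>G\<close> of \<open>g\<close>, up to the affine change
  of variable \<open>G(v(x)) = (l - x) / \<epsilon>\<close>. Differentiability is needed up to the end points, so the
  difference quotients of \<open>v\<close> are obtained as reciprocals of those of \<open>G\<close> within \<open>[a, b]\<close>.\<close>

lemma travel_profile_exists: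
  assumes g: "continuous_on {a..b} g" "\<And>s. s \<in> {a..b} \<Longrightarrow> g s > 0"
    and "\<epsilon> > 0" "l > 0" "a < b"
    and time: "integral {a..b} g = 2 * l / \<epsilon>"
  obtains v where "v \<in> extensional {-l..l}" "v ` {-l..l} \<subseteq> {a..b}" "v (-l) = b" "v l = a"
    "strict_antimono_on {-l..l} v"
    "\<And>x. x \<in> {-l..l} \<Longrightarrow> (v has_real_derivative - 1 / (\<epsilon> * g (v x))) (at x within {-l..l})"
proof -
  define G where "G u = integral {a..u} g" for u
  have G_deriv: "(G has_real_derivative g u) (at u within {a..b})" if "u \<in> {a..b}" for u
    unfolding G_def using integral_has_real_derivative[OF g(1) that] .
  have G_cont: "continuous_on {a..b} G"
    using G_deriv by (rule DERIV_continuous_on)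
  have G_mono: "G c < G d" if "c \<in> {a..b}" "d \<in> {a..b}" "c < d" for c d
    unfolding G_def using integral_upper_strict_mono[OF g that] .
  have G_inj: "inj_on G {a..b}"
    by (intro linorder_inj_onI') (use G_mono in force)
  have G_end: "G a = 0" "G b = 2 * l / \<epsilon>" by (auto simp: G_def time)
  have "\<exists>u\<in>{a..b}. G u = (l - x) / \<epsilon>" if "x \<in> {-l..l}" for x
  proof -
    have "G a \<le> (l - x) / \<epsilon>" "(l - x) / \<epsilon> \<le> G b"
      using that \<open>\<epsilon> > 0\<close> by (auto simp: G_end divide_le_cancel)
    from IVT'[OF this _ G_cont] \<open>a < b\<close> show ?thesis by auto
  qed
  then obtain v0 where v0: "v0 x \<in> {a..b}" "G (v0 x) = (l - x) / \<epsilon>" if "x \<in> {-l..l}" for x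
    by metis
  define v where "v = restrict v0 {-l..l}"
  have v: "v x \<in> {a..b}" "G (v x) = (l - x) / \<epsilon>" if "x \<in> {-l..l}" for x
    using v0[OF that] that by (auto simp: v_def)
  have inv: "v (l - \<epsilon> * G u) = u" if "u \<in> {a..b}" for u
  proof -
    have "0 \<le> G u" "G u \<le> 2 * l / \<epsilon>"
      using G_mono[of a u] G_mono[of u b] that G_end by (cases "u = a"; cases "u = b"; force)+
    then have "l - \<epsilon> * G u \<in> {-l..l}" using \<open>\<epsilon> > 0\<close> by (auto simp: field_simps)
    then show ?thesis
      using v[of "l - \<epsilon> * G u"] that G_inj \<open>\<epsilon> > 0\<close> by (auto simp: inj_on_def)
  qed
  have img: "(\<lambda>u. l - \<epsilon> * G u) ` {a..b} = {-l..l}"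
  proof (intro equalityI subsetI)
    fix x assume "x \<in> {-l..l}"
    with v[of x] \<open>\<epsilon> > 0\<close> show "x \<in> (\<lambda>u. l - \<epsilon> * G u) ` {a..b}"
      by (intro image_eqI[of _ _ "v x"]) auto
  next
    fix x assume "x \<in> (\<lambda>u. l - \<epsilon> * G u) ` {a..b}"
    then obtain u where u: "u \<in> {a..b}" "x = l - \<epsilon> * G u" by auto
    have "0 \<le> G u" "G u \<le> 2 * l / \<epsilon>"
      using G_mono[of a u] G_mono[of u b] u(1) G_end by (cases "u = a"; cases "u = b"; force)+
    then show "x \<in> {-l..l}" using \<open>\<epsilon> > 0\<close> u(2) by (auto simp: field_simps)
  qed
  have v_cont: "continuous_on {-l..l} v"
    unfolding img[symmetric]
    by (intro continuous_on_inv) (use G_cont inv in \<open>auto intro!: continuous_intros\<close>)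
  have anti: "strict_antimono_on {-l..l} v"
  proof (rule monotone_onI)
    fix x y assume xy: "x \<in> {-l..l}" "y \<in> {-l..l}" "x < y"
    then have "G (v y) < G (v x)" using v \<open>\<epsilon> > 0\<close> by (simp add: divide_strict_right_mono)
    then show "v y < v x"
      using G_mono[of "v x" "v y"] v xy by (cases "v x" "v y" rule: linorder_cases) auto
  qed
  have v_deriv: "(v has_real_derivative - 1 / (\<epsilon> * g (v x))) (at x within {-l..l})"
    if x: "x \<in> {-l..l}" for x
  proof -
    have "filterlim v (at (v x) within {a..b}) (at x within {-l..l})"
      unfolding filterlim_at
    proof
      show "(v \<longlongrightarrow> v x) (at x within {-l..l})"
        using v_cont x by (auto simp: continuous_on_def)
      have "v y \<noteq> v x" if "y \<in> {-l..l}" "y \<noteq> x" for y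
        using v(2)[OF x] v(2)[of y] that \<open>\<epsilon> > 0\<close> by auto
      then show "\<forall>\<^sub>F y in at x within {-l..l}. v y \<in> {a..b} \<and> v y \<noteq> v x"
        using v(1) by (auto simp: eventually_at_filter)
    qed
    from filterlim_compose[OF G_deriv[OF v(1)[OF x], unfolded has_field_derivative_iff] this]
    have "((\<lambda>y. (G (v y) - G (v x)) / (v y - v x)) \<longlongrightarrow> g (v x)) (at x within {-l..l})" .
    then have lim: "((\<lambda>y. (- 1 / \<epsilon>) * inverse ((G (v y) - G (v x)) / (v y - v x)))
        \<longlongrightarrow> (- 1 / \<epsilon>) * inverse (g (v x))) (at x within {-l..l})"
      using g(2)[OF v(1)[OF x]] by (intro tendsto_intros) auto
    have quot: "(- 1 / \<epsilon>) * inverse ((G (v y) - G (v x)) / (v y - v x)) = (v y - v x) / (y - x)"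
      if "y \<in> {-l..l}" "y \<noteq> x" for y
    proof -
      have G_diff: "G (v y) - G (v x) = - ((y - x) / \<epsilon>)"
        using v(2)[OF x] v(2)[OF that(1)] by (simp add: diff_divide_distrib)
      show ?thesis
        unfolding G_diff using that(2) \<open>\<epsilon> > 0\<close> by simp (metis minus_diff_eq minus_divide_left)
    qed
    have ev: "\<forall>\<^sub>F y in at x within {-l..l}.
        (- 1 / \<epsilon>) * inverse ((G (v y) - G (v x)) / (v y - v x)) = (v y - v x) / (y - x)"
      using quot by (simp add: eventually_at_filter)
    have "((\<lambda>y. (v y - v x) / (y - x)) \<longlongrightarrow> (- 1 / \<epsilon>) * inverse (g (v x))) (at x within {-l..l})"
      by (rule Lim_transform_eventually[OF lim ev])
    then show ?thesis
      by (simp add: has_field_derivative_iff divide_simps)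
  qed
  show thesis
  proof
    show "v \<in> extensional {-l..l}" by (simp add: v_def)
    show "v ` {-l..l} \<subseteq> {a..b}" using v by auto
    show "v (-l) = b" using inv[of b] \<open>a < b\<close> \<open>\<epsilon> > 0\<close> by (simp add: G_end)
    show "v l = a" using inv[of a] \<open>a < b\<close> by (simp add: G_end)
  qed (use anti v_deriv in auto)
qed

section \<open>From the boundary value problem to a travel time\<close>

lemma C1_on_IccI:
  assumes "a < b"
    and "\<And>x. x \<in> {a..b} \<Longrightarrow> (g has_real_derivative g' x) (at x within {a..b})"
    and "continuous_on {a..b} g'"
  shows "C1_on {a..b} g"
proof -
  have "vector_derivative g (at x within {a..b}) = g' x" if "x \<in> {a..b}" for x
    using assms that
    by (intro vector_derivative_within_closed_interval)
       (auto simp flip: has_real_derivative_iff_has_vector_derivative)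
  then have "continuous_on {a..b} (\<lambda>x. vector_derivative g (at x within {a..b}))"
    using assms(3) by (subst continuous_on_cong[OF refl, of _ _ g']) auto
  moreover have "g differentiable (at x within {a..b})" if "x \<in> {a..b}" for x
    using assms(2)[OF that] real_differentiable_def by blast
  ultimately show ?thesis by (auto simp: C1_on_def)
qed

lemma C1_onD:
  assumes "C1_on S g"
  shows "x \<in> S \<Longrightarrow> (g has_real_derivative vector_derivative g (at x within S)) (at x within S)"
    and "continuous_on S (\<lambda>x. vector_derivative g (at x within S))"
  using assms
  by (auto simp: C1_on_def vector_derivative_works has_real_derivative_iff_has_vector_derivative)

lemma dx_eqI:
  assumes "(g has_real_derivative d) (at x within {-l..l})" "x \<in> {-l..l}" "l > 0"
  shows "dx l g x = d"
  unfolding dx_def using assms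
  by (intro vector_derivative_within_closed_interval)
     (auto simp flip: has_real_derivative_iff_has_vector_derivative)

lemma Q_derivative: "(Q has_real_derivative (1 - s\<^sup>2) / (1 + s\<^sup>2)\<^sup>2) (at s)"
proof -
  have "1 + s\<^sup>2 \<noteq> 0" using zero_le_power2[of s] by linarith
  then show ?thesis
    unfolding Q_def by (auto intro!: derivative_eq_intros simp: power2_eq_square algebra_simps)
qed

locale viscous_bvp =
  fixes f :: "real \<Rightarrow> real" and \<epsilon> l um up m M :: real
  assumes \<epsilon>_pos: "\<epsilon> > 0" and l_pos: "l > 0"
    and f_C2: "C2_on UNIV f"
    and up_less_um: "up < um"
    and m_attained: "m \<in> f ` {up..um}" and m_le: "\<And>u. u \<in> {up..um} \<Longrightarrow> m \<le> f u"
    and M_attained: "M \<in> f ` {up..um}" and le_M: "\<And>u. u \<in> {up..um} \<Longrightarrow> f u \<le> M"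
begin

abbreviation solves :: "(real \<Rightarrow> real) \<Rightarrow> bool" where
  "solves \<equiv> decreasing_solution \<epsilon> l f um up"

lemma f_derivative: "(f has_real_derivative deriv f u) (at u)"
  and continuous_on_deriv_f: "continuous_on S (deriv f)"
proof -
  have C1: "C1_on UNIV f" using f_C2 by (simp add: C2_on_def)
  then have D: "(f has_real_derivative vector_derivative f (at u)) (at u)" for u
    using C1_onD(1)[OF C1] by simp
  then have eq: "deriv f u = vector_derivative f (at u)" for u
    by (rule DERIV_imp_deriv)
  then have *: "deriv f = (\<lambda>u. vector_derivative f (at u))" by auto
  show "(f has_real_derivative deriv f u) (at u)" using D eq by simp
  show "continuous_on S (deriv f)"
    using C1_onD(2)[OF C1] unfolding * by (rule continuous_on_subset) auto
qed

lemma continuous_on_f: "continuous_on S f"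
  by (intro continuous_at_imp_continuous_on ballI DERIV_isCont[OF f_derivative])

lemma solution_regular:
  assumes "solves v"
  shows "\<And>x. x \<in> {-l..l} \<Longrightarrow> (v has_real_derivative dx l v x) (at x within {-l..l})"
    and "\<And>x. x \<in> {-l..l} \<Longrightarrow> (dx l v has_real_derivative dx l (dx l v) x) (at x within {-l..l})"
    and "continuous_on {-l..l} (dx l v)"
proof -
  have eq: "dx l v = (\<lambda>x. vector_derivative v (at x within {-l..l}))" by (auto simp: dx_def)
  have C1: "C1_on {-l..l} v" "C1_on {-l..l} (dx l v)"
    using assms by (auto simp: decreasing_solution_def C2_on_def eq)
  show "(v has_real_derivative dx l v x) (at x within {-l..l})" if "x \<in> {-l..l}" for x
    using C1_onD(1)[OF C1(1) that] by (simp add: eq)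
  show "(dx l v has_real_derivative dx l (dx l v) x) (at x within {-l..l})" if "x \<in> {-l..l}" for x
    using C1_onD(1)[OF C1(2) that] by (simp add: dx_def[of l "dx l v"])
  show "continuous_on {-l..l} (dx l v)"
    using C1_onD(2)[OF C1(1)] by (simp add: eq)
qed

lemma solution_range: "v ` {-l..l} = {up..um}" if "solves v"
proof -
  have ends: "v (-l) = um" "v l = up" and anti: "strict_antimono_on {-l..l} v"
    using that by (auto simp: decreasing_solution_def)
  have cont: "continuous_on {-l..l} v"
    using solution_regular(1)[OF that] by (rule DERIV_continuous_on)
  show ?thesis
  proof (intro equalityI subsetI)
    fix u assume "u \<in> v ` {-l..l}"
    then obtain x where x: "x \<in> {-l..l}" "u = v x" by auto
    have "v l \<le> v x" "v x \<le> v (-l)"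
      using monotone_onD[OF anti, of x l] monotone_onD[OF anti, of "-l" x] x l_pos
      by (cases "x = l"; cases "x = -l"; force)+
    then show "u \<in> {up..um}" using x ends by simp
  next
    fix u assume "u \<in> {up..um}"
    then show "u \<in> v ` {-l..l}"
      using IVT2'[OF _ _ _ cont, of u] ends l_pos by auto
  qed
qed

text \<open>The constant of integration is named so that it bounds \<open>f\<close> from above: \<open>Q\<close> is odd and
  \<open>- \<epsilon> v'\<close> is the nonnegative quantity.\<close>

lemma first_integral:
  assumes "solves v"
  obtains K where "\<And>x. x \<in> {-l..l} \<Longrightarrow> Q (- \<epsilon> * dx l v x) = K - f (v x)"
proof -
  define Q' where "Q' s = (1 - s\<^sup>2) / (1 + s\<^sup>2)\<^sup>2" for s :: real
  have Q': "(Q has_real_derivative Q' s) (at s)" for s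
    unfolding Q'_def by (rule Q_derivative)
  have dQ: "((\<lambda>y. Q (\<epsilon> * dx l v y)) has_real_derivative Q' (\<epsilon> * dx l v x) * (\<epsilon> * dx l (dx l v) x))
      (at x within {-l..l})" if "x \<in> {-l..l}" for x
    using DERIV_chain2[OF Q' DERIV_cmult[OF solution_regular(2)[OF assms that]]] .
  have df: "((\<lambda>y. f (v y)) has_real_derivative deriv f (v x) * dx l v x) (at x within {-l..l})"
    if "x \<in> {-l..l}" for x
    using DERIV_chain2[OF f_derivative solution_regular(1)[OF assms that]] .
  let ?F = "\<lambda>y. f (v y) - Q (\<epsilon> * dx l v y)"
  have dF: "(?F has_real_derivative deriv f (v x) * dx l v x - Q' (\<epsilon> * dx l v x) * (\<epsilon> * dx l (dx l v) x))
      (at x within {-l..l})" if "x \<in> {-l..l}" for x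
    using DERIV_diff[OF df dQ] that by blast
  \<comment> \<open>The equation is only assumed in the open interval; continuity carries constancy to the end
    points.\<close>
  have *: "?F x = ?F l" if "x \<in> {-l..l}" for x
  proof (rule has_derivative_zero_unique_strong_convex[of "{-l..l}" "{-l, l}" ?F l])
    show "continuous_on {-l..l} ?F" using dF by (rule DERIV_continuous_on)
    fix x assume "x \<in> {-l..l} - {-l, l}"
    then have x: "x \<in> {-l..l}" "x \<in> {-l<..<l}" by auto
    have "Q' (\<epsilon> * dx l v x) * (\<epsilon> * dx l (dx l v) x) = deriv f (v x) * dx l v x"
      using dx_eqI[OF dQ[OF x(1)] x(1) l_pos] dx_eqI[OF df[OF x(1)] x(1) l_pos] assms x(2)
      by (simp add: decreasing_solution_def)
    with dF[OF x(1)] show "(?F has_derivative (\<lambda>h. 0)) (at x within {-l..l})"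
      by (simp add: has_field_derivative_def lambda_zero)
  qed (use that l_pos in auto)
  then have "Q (- \<epsilon> * dx l v x) = ?F l - f (v x)" if "x \<in> {-l..l}" for x
    using that[THEN *] by (simp add: Q_def)
  then show thesis using that by blast
qed

text \<open>Here \<open>r\<close> stands for either branch of the inverse of \<open>Q\<close>. The strict bounds on \<open>K\<close> keep
  \<open>K - f\<close> inside \<open>(0, 1/2)\<close>, where both branches are continuously differentiable, so that \<open>v\<close>
  inherits a continuous second derivative. At the level \<open>1/2\<close> neither branch is differentiable, and
  at the level \<open>0\<close> the fast branch blows up.\<close>

lemma solution_exists:
  assumes K: "M < K" "K < m + 1/2"
    and r: "\<And>y. 0 < y \<Longrightarrow> y < 1/2 \<Longrightarrow> 0 < r y \<and> Q (r y) = y"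
    and r': "\<And>y. 0 < y \<Longrightarrow> y < 1/2 \<Longrightarrow> (r has_real_derivative r' y) (at y)"
      "continuous_on {0<..<1/2} r'"
    and time: "integral {up..um} (\<lambda>s. 1 / r (K - f s)) = 2 * l / \<epsilon>"
  obtains v where "solves v"
    and "\<And>x. x \<in> {-l..l} \<Longrightarrow> 0 < K - f (v x) \<and> K - f (v x) < 1/2 \<and> dx l v x = - r (K - f (v x)) / \<epsilon>"
proof -
  have K_f: "0 < K - f s" "K - f s < 1/2" if "s \<in> {up..um}" for s
    using K m_le[OF that] le_M[OF that] by auto
  have r_cont: "continuous_on {0<..<1/2} r"
    using r'(1) by (intro DERIV_continuous_on[of _ r r']) (auto intro: DERIV_subset)
  have "continuous_on {up..um} (\<lambda>s. r (K - f s))"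
    by (intro continuous_on_compose2[OF r_cont] continuous_intros continuous_on_f) (use K_f in auto)
  then have "continuous_on {up..um} (\<lambda>s. 1 / r (K - f s))"
    using r K_f by (intro continuous_intros) (auto simp: less_imp_neq[symmetric])
  from travel_profile_exists[OF this _ \<epsilon>_pos l_pos up_less_um time]
  obtain v where v: "v \<in> extensional {-l..l}" "v ` {-l..l} \<subseteq> {up..um}" "v (-l) = um" "v l = up"
    "strict_antimono_on {-l..l} v"
    and v_deriv0: "\<And>x. x \<in> {-l..l} \<Longrightarrow>
       (v has_real_derivative - 1 / (\<epsilon> * (1 / r (K - f (v x))))) (at x within {-l..l})"
    using r K_f by auto
  define w where "w x = - r (K - f (v x)) / \<epsilon>" for x
  have v_in: "v x \<in> {up..um}" if "x \<in> {-l..l}" for x using v(2) that by blast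
  have v_deriv: "(v has_real_derivative w x) (at x within {-l..l})" if "x \<in> {-l..l}" for x
    using v_deriv0[OF that] by (simp add: w_def)
  have v_cont: "continuous_on {-l..l} v" using v_deriv by (rule DERIV_continuous_on)
  have fv_deriv: "((\<lambda>x. f (v x)) has_real_derivative deriv f (v x) * w x) (at x within {-l..l})"
    if "x \<in> {-l..l}" for x
    using DERIV_chain2[OF f_derivative v_deriv[OF that]] .
  define w' where "w' x = - (r' (K - f (v x)) * (0 - deriv f (v x) * w x)) / \<epsilon>" for x
  have w_deriv: "(w has_real_derivative w' x) (at x within {-l..l})" if "x \<in> {-l..l}" for x
    unfolding w_def[abs_def] w'_def
    by (intro DERIV_cdivide DERIV_minus DERIV_chain2[OF r'(1)] DERIV_diff DERIV_const fv_deriv[unfolded w_def] that)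
       (use K_f[OF v_in[OF that]] in \<open>auto simp: w_def\<close>)
  have w_cont: "continuous_on {-l..l} w" using w_deriv by (rule DERIV_continuous_on)
  have w'_cont: "continuous_on {-l..l} w'"
    unfolding w'_def using \<epsilon>_pos K_f[OF v_in]
    by (intro continuous_intros w_cont continuous_on_compose2[OF r'(2)]
        continuous_on_compose2[OF continuous_on_deriv_f[of UNIV] v_cont]
        continuous_on_compose2[OF continuous_on_f[of UNIV] v_cont]) auto
  have dx_v: "dx l v x = w x" if "x \<in> {-l..l}" for x
    using dx_eqI[OF v_deriv] that l_pos by blast
  have "C1_on {-l..l} v"
    using l_pos v_deriv w_cont by (intro C1_on_IccI) auto
  moreover have "C1_on {-l..l} (\<lambda>x. vector_derivative v (at x within {-l..l}))"
  proof (rule C1_on_IccI)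
    fix x assume x: "x \<in> {-l..l}"
    show "((\<lambda>x. vector_derivative v (at x within {-l..l})) has_real_derivative w' x) (at x within {-l..l})"
      by (rule has_field_derivative_transform_within[OF w_deriv[OF x] zero_less_one x]) (use dx_v in \<open>auto simp: dx_def\<close>)
  qed (use l_pos w'_cont in auto)
  moreover have "dx l (\<lambda>y. Q (\<epsilon> * dx l v y)) x = dx l (\<lambda>y. f (v y)) x" if "x \<in> {-l<..<l}" for x
  proof -
    have x: "x \<in> {-l..l}" using that by auto
    have Q_eq: "Q (\<epsilon> * dx l v y) = f (v y) - K" if "y \<in> {-l..l}" for y
    proof -
      have "Q (\<epsilon> * dx l v y) = Q (- r (K - f (v y)))"
        using dx_v[OF that] \<epsilon>_pos by (simp add: w_def)
      also have "\<dots> = - Q (r (K - f (v y)))" by (simp add: Q_def)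
      finally show ?thesis using r K_f[OF v_in[OF that]] by auto
    qed
    have "((\<lambda>y. f (v y) - K) has_real_derivative deriv f (v x) * w x) (at x within {-l..l})"
      using DERIV_diff[OF fv_deriv[OF x] DERIV_const[of K]] by simp
    then have "((\<lambda>y. Q (\<epsilon> * dx l v y)) has_real_derivative deriv f (v x) * w x) (at x within {-l..l})"
      by (rule has_field_derivative_transform_within[OF _ zero_less_one x]) (use Q_eq in auto)
    then show ?thesis
      using dx_eqI[OF _ x l_pos] fv_deriv[OF x] by metis
  qed
  ultimately have "solves v"
    using v by (simp add: decreasing_solution_def C2_on_def)
  then show thesis
    using that dx_v K_f v_in by (auto simp: w_def)
qed

text \<open>The weight \<open>g\<close> fixes \<open>integral {up..v x} g\<close> for every \<open>x\<close>, and this integral determines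
  \<open>v x\<close>.\<close>

lemma travel_time_unique:
  assumes g: "continuous_on {up..um} g" "\<And>s. s \<in> {up..um} \<Longrightarrow> g s > 0"
    and "solves v" "\<And>x. x \<in> {-l..l} \<Longrightarrow> g (v x) * dx l v x = - 1 / \<epsilon>"
    and "solves w" "\<And>x. x \<in> {-l..l} \<Longrightarrow> g (w x) * dx l w x = - 1 / \<epsilon>"
  shows "v = w"
proof (rule extensionalityI)
  show "v \<in> extensional {-l..l}" "w \<in> extensional {-l..l}"
    using assms by (auto simp: decreasing_solution_def)
  have in_range: "v x \<in> {up..um}" "w x \<in> {up..um}" if "x \<in> {-l..l}" for x
    using solution_range assms(3,5) that by blast+
  have "v l = up" "w l = up" using assms by (auto simp: decreasing_solution_def)
  then have "integral {up..v x} g = integral {up..w x} g" if "x \<in> {-l..l}" for x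
    using travel_time_eq[OF g(1) \<epsilon>_pos l_pos, of v "dx l v" x]
      travel_time_eq[OF g(1) \<epsilon>_pos l_pos, of w "dx l w" x]
      solution_regular(1)[OF assms(3)] solution_regular(1)[OF assms(5)] in_range assms that
    by simp
  then show "v x = w x" if "x \<in> {-l..l}" for x
    using integral_upper_strict_mono[OF g] in_range[OF that] that
    by (metis less_irrefl linorder_neqE)
qed

lemma solution_time:
  assumes g: "continuous_on {up..um} g"
    and "solves v" "\<And>x. x \<in> {-l..l} \<Longrightarrow> g (v x) * dx l v x = - 1 / \<epsilon>"
  shows "integral {up..um} g = 2 * l / \<epsilon>"
proof -
  have "v x \<in> {up..um}" if "x \<in> {-l..l}" for x
    using solution_range[OF assms(2)] that by blast
  moreover have "v l = up" "v (-l) = um" using assms by (auto simp: decreasing_solution_def)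
  ultimately show ?thesis
    using travel_time_eq[OF g \<epsilon>_pos l_pos, of v "dx l v" "-l"]
      solution_regular(1)[OF assms(2)] assms(3) l_pos by simp
qed

section \<open>Travel times as functions of the integration constant\<close>

definition slow_time :: "real \<Rightarrow> real" where
  "slow_time K = integral {up..um} (\<lambda>s. 1 / Q_inv (K - f s))"

definition fast_time :: "real \<Rightarrow> real" where
  "fast_time K = integral {up..um} (\<lambda>s. Q_inv (K - f s))"

lemma level_bounds:
  assumes "s \<in> {up..um}"
  shows "K - M \<le> K - f s" "K - f s \<le> K - m"
  using m_le[OF assms] le_M[OF assms] by auto

lemma continuous_on_Q_inv_level:
  "continuous_on ({M..m + 1/2} \<times> {up..um}) (\<lambda>(K, s). Q_inv (K - f s))"
  unfolding case_prod_unfold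
  by (intro continuous_on_compose2[OF continuous_on_Q_inv] continuous_intros
      continuous_on_compose2[OF continuous_on_f[of UNIV]])
     (use level_bounds in force)+

lemma continuous_on_fast_integrand:
  assumes "K \<in> {M..m + 1/2}"
  shows "continuous_on {up..um} (\<lambda>s. Q_inv (K - f s))"
  by (intro continuous_on_compose2[OF continuous_on_Q_inv] continuous_intros continuous_on_f)
     (use assms level_bounds[of _ K] in force)

lemma fast_integrand_pos:
  assumes "K \<in> {M<..m + 1/2}" "s \<in> {up..um}"
  shows "0 < Q_inv (K - f s)"
  using level_bounds[OF assms(2), of K] assms(1) by (intro Q_inv_pos) auto

lemma continuous_on_slow_integrand:
  assumes "K \<in> {M<..m + 1/2}"
  shows "continuous_on {up..um} (\<lambda>s. 1 / Q_inv (K - f s))"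
  using assms fast_integrand_pos[OF assms]
  by (intro continuous_intros continuous_on_fast_integrand) (auto simp: less_imp_neq[symmetric])

lemma continuous_on_fast_time: "continuous_on {M..m + 1/2} fast_time"
  using integral_continuous_on_param[of "{M..m + 1/2}" up um "\<lambda>K s. Q_inv (K - f s)"]
    continuous_on_Q_inv_level
  by (simp add: fast_time_def[abs_def])

lemma continuous_on_slow_time: "continuous_on {M<..m + 1/2} slow_time"
proof -
  have "continuous_on ({M<..m + 1/2} \<times> {up..um}) (\<lambda>(K, s). Q_inv (K - f s))"
    by (rule continuous_on_subset[OF continuous_on_Q_inv_level]) auto
  then have "continuous_on ({M<..m + 1/2} \<times> {up..um}) (\<lambda>(K, s). 1 / Q_inv (K - f s))"
    using fast_integrand_pos
    by (auto intro!: continuous_intros simp: case_prod_unfold less_imp_neq[symmetric])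
  then show ?thesis
    using integral_continuous_on_param[of "{M<..m + 1/2}" up um "\<lambda>K s. 1 / Q_inv (K - f s)"]
    by (simp add: slow_time_def[abs_def])
qed

lemma fast_time_strict_mono:
  assumes "M \<le> K" "K < K'" "K' \<le> m + 1/2"
  shows "fast_time K < fast_time K'"
  unfolding fast_time_def
proof (rule integral_less_real)
  fix s assume "s \<in> {up<..<um}"
  then show "Q_inv (K - f s) < Q_inv (K' - f s)"
    using assms level_bounds[of s K] level_bounds[of s K'] by (intro Q_inv_strict_mono) auto
qed (use assms up_less_um in \<open>auto intro: continuous_on_fast_integrand\<close>)

lemma slow_time_strict_antimono:
  assumes "M < K" "K < K'" "K' \<le> m + 1/2"
  shows "slow_time K' < slow_time K"
  unfolding slow_time_def
proof (rule integral_less_real)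
  fix s assume s: "s \<in> {up<..<um}"
  then have "Q_inv (K - f s) < Q_inv (K' - f s)"
    using assms level_bounds[of s K] level_bounds[of s K'] by (intro Q_inv_strict_mono) auto
  moreover have "0 < Q_inv (K - f s)"
    using assms s by (intro fast_integrand_pos) auto
  ultimately show "1 / Q_inv (K' - f s) < 1 / Q_inv (K - f s)"
    by (intro divide_strict_left_mono) auto
qed (use assms up_less_um in \<open>auto intro: continuous_on_slow_integrand\<close>)

lemma fast_time_M: "fast_time M = L_minus f M um up"
  unfolding fast_time_def L_minus_def Q_inv_def by (simp add: power2_commute)

text \<open>At \<open>K = m + 1/2\<close> the expression under the root factors, as
  \<open>1 - 4 (1/2 - a)\<^sup>2 = 4 a (1 - a)\<close>.\<close>

lemma Q_inv_top_level:
  "Q_inv (m + 1/2 - f s) = (1 - 2 * (f s - m)) / (1 + 2 * sqrt ((f s - m) * (1 - (f s - m))))"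
proof -
  have "1 - 4 * (m + 1/2 - f s)\<^sup>2 = 4 * ((f s - m) * (1 - (f s - m)))"
    by (simp add: power2_eq_square algebra_simps)
  then show ?thesis
    unfolding Q_inv_def by (simp only: real_sqrt_mult real_sqrt_four) (simp add: algebra_simps)
qed

lemma fast_time_top: "fast_time (m + 1/2) = L_plus f m um up"
  by (simp only: fast_time_def L_plus_def Q_inv_top_level)

lemma slow_time_top: "slow_time (m + 1/2) = B_int f m um up"
  by (simp add: slow_time_def B_int_def Q_inv_top_level)

lemma f_near_maximum:
  "\<exists>C>0. \<exists>s0\<in>{up..um}. \<forall>s\<in>{up..um}. M - f s \<le> C * \<bar>s - s0\<bar>"
proof -
  obtain s0 where s0: "s0 \<in> {up..um}" "f s0 = M" using M_attained by auto
  have "bounded (deriv f ` {up..um})"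
    by (intro compact_imp_bounded compact_continuous_image continuous_on_deriv_f compact_Icc)
  then obtain C where C: "C > 0" "\<And>u. u \<in> {up..um} \<Longrightarrow> norm (deriv f u) \<le> C"
    unfolding bounded_pos by auto
  have "M - f s \<le> C * \<bar>s - s0\<bar>" if "s \<in> {up..um}" for s
    using field_differentiable_bound[of "{up..um}" f "deriv f" C s s0]
      f_derivative C(2) s0 that by (force intro: DERIV_subset)
  with C(1) s0(1) show ?thesis by blast
qed

text \<open>The maximum point \<open>s0\<close> may be an end point of \<open>[up, um]\<close>, so the lower bound uses an interval
  \<open>[c, d]\<close> on one side of it. There \<open>1 / Q_inv (K - f s)\<close> is at least
  \<open>1 / (2 (K - M + C \<bar>s - s0\<bar>))\<close>, whose integral is a logarithm.\<close>

lemma slow_time_ge_log: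
  assumes "C > 0" "s0 \<in> {c, d}" "up \<le> c" "c < d" "d \<le> um"
    and C: "\<And>s. s \<in> {up..um} \<Longrightarrow> M - f s \<le> C * \<bar>s - s0\<bar>"
    and K: "M < K" "K \<le> m + 1/2"
  shows "ln (1 + C * (d - c) / (K - M)) / (2 * C) \<le> slow_time K"
proof -
  define \<delta> where "\<delta> = K - M"
  have \<delta>: "0 < \<delta>" using K by (simp add: \<delta>_def)
  \<comment> \<open>The sign of \<open>s - s0\<close> on \<open>[c, d]\<close>; it makes a single primitive serve both sides.\<close>
  define \<sigma> where "\<sigma> = (if s0 = c then 1 else -1 :: real)"
  have abs: "\<bar>s - s0\<bar> = \<sigma> * (s - s0)" if "s \<in> {c..d}" for s
    using that assms(2) by (auto simp: \<sigma>_def)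
  have \<sigma>: "\<sigma> * \<sigma> = 1" by (simp add: \<sigma>_def)
  have pos: "0 < \<delta> + C * (\<sigma> * (s - s0))" if "s \<in> {c..d}" for s
    unfolding abs[OF that, symmetric] using \<open>C > 0\<close> \<delta> by (simp add: add_pos_nonneg)
  define F where "F s = \<sigma> * ln (\<delta> + C * (\<sigma> * (s - s0))) / (2 * C)" for s
  have has_int: "((\<lambda>s. 1 / (2 * (\<delta> + C * (\<sigma> * (s - s0))))) has_integral F d - F c) {c..d}"
  proof (rule fundamental_theorem_of_calculus)
    fix s assume "s \<in> {c..d}"
    from pos[OF this] have "((\<lambda>s. ln (\<delta> + C * (\<sigma> * (s - s0)))) has_real_derivative
        1 / (\<delta> + C * (\<sigma> * (s - s0))) * (C * \<sigma>)) (at s within {c..d})"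
      by (auto intro!: derivative_eq_intros)
    from DERIV_cdivide[OF DERIV_cmult[OF this, of \<sigma>], of "2 * C"]
    have "(F has_real_derivative
        \<sigma> * (1 / (\<delta> + C * (\<sigma> * (s - s0))) * (C * \<sigma>)) / (2 * C)) (at s within {c..d})"
      unfolding F_def .
    moreover have "\<sigma> * (1 / D * (C * \<sigma>)) / (2 * C) = 1 / (2 * D)" for D :: real
    proof -
      have "\<sigma> * (1 / D * (C * \<sigma>)) / (2 * C) = (\<sigma> * \<sigma>) * (C / (2 * C)) / D" by simp
      then show ?thesis using \<open>C > 0\<close> by (simp add: \<sigma>)
    qed
    ultimately show "(F has_vector_derivative 1 / (2 * (\<delta> + C * (\<sigma> * (s - s0))))) (at s within {c..d})"
      by (simp add: has_real_derivative_iff_has_vector_derivative)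
  qed (use assms in auto)
  have F_diff: "F d - F c = ln (1 + C * (d - c) / \<delta>) / (2 * C)"
  proof -
    have "0 < \<delta> + C * (d - c)" using assms \<delta> by (simp add: add_pos_pos)
    moreover have "1 + C * (d - c) / \<delta> = (\<delta> + C * (d - c)) / \<delta>" using \<delta> by (simp add: field_simps)
    ultimately have log_eq: "ln (1 + C * (d - c) / \<delta>) = ln (\<delta> + C * (d - c)) - ln \<delta>"
      using \<delta> by (simp add: ln_div)
    have "F d - F c = (ln (\<delta> + C * (d - c)) - ln \<delta>) / (2 * C)"
      using assms(2) by (auto simp: F_def \<sigma>_def diff_divide_distrib)
    then show ?thesis by (simp only: log_eq)
  qed
  have "ln (1 + C * (d - c) / \<delta>) / (2 * C) = integral {c..d} (\<lambda>s. 1 / (2 * (\<delta> + C * (\<sigma> * (s - s0)))))"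
    by (simp only: F_diff integral_unique[OF has_int])
  also have "\<dots> \<le> integral {c..d} (\<lambda>s. 1 / Q_inv (K - f s))"
  proof (rule integral_le[OF has_integral_integrable[OF has_int]])
    show "(\<lambda>s. 1 / Q_inv (K - f s)) integrable_on {c..d}"
      using assms K
      by (intro integrable_continuous_real continuous_on_subset[OF continuous_on_slow_integrand]) auto
    fix s assume s: "s \<in> {c..d}"
    then have s': "s \<in> {up..um}" using assms by auto
    have "Q_inv (K - f s) \<le> 2 * (K - f s)"
      using level_bounds[OF s', of K] K by (intro Q_inv_le_double) auto
    also have "\<dots> \<le> 2 * (\<delta> + C * (\<sigma> * (s - s0)))"
      using C[OF s'] abs[OF s] by (simp add: \<delta>_def)
    finally show "1 / (2 * (\<delta> + C * (\<sigma> * (s - s0)))) \<le> 1 / Q_inv (K - f s)"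
      using pos[OF s] fast_integrand_pos[OF _ s', of K] K by (intro divide_left_mono) auto
  qed
  also have "\<dots> \<le> slow_time K"
    unfolding slow_time_def
  proof (rule integral_subset_le)
    show "{c..d} \<subseteq> {up..um}" using assms by auto
    show "(\<lambda>s. 1 / Q_inv (K - f s)) integrable_on {up..um}"
      using K by (intro integrable_continuous_real continuous_on_slow_integrand) auto
    show "(\<lambda>s. 1 / Q_inv (K - f s)) integrable_on {c..d}"
      using assms K
      by (intro integrable_continuous_real continuous_on_subset[OF continuous_on_slow_integrand]) auto
    show "\<forall>s\<in>{up..um}. 0 \<le> 1 / Q_inv (K - f s)"
      using fast_integrand_pos[of K] K by (simp add: less_imp_le)
  qed
  finally show ?thesis by (simp add: \<delta>_def)
qed

lemma slow_time_unbounded: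
  assumes "M - m < 1/2"
  obtains K where "M < K" "K < m + 1/2" "N < slow_time K"
proof -
  obtain C s0 where C: "C > 0" "s0 \<in> {up..um}"
    "\<And>s. s \<in> {up..um} \<Longrightarrow> M - f s \<le> C * \<bar>s - s0\<bar>"
    using f_near_maximum by blast
  obtain c d where cd: "s0 \<in> {c, d}" "up \<le> c" "c < d" "d \<le> um"
  proof (cases "s0 < um")
    case True then show thesis using that[of s0 um] C(2) by auto
  next
    case False then show thesis using that[of up s0] C(2) up_less_um by auto
  qed
  \<comment> \<open>The first bound keeps \<open>M + \<delta>\<close> below \<open>m + 1/2\<close>, the second makes the logarithm exceed
    \<open>2 C N\<close>.\<close>
  define \<delta> where "\<delta> = min ((m + 1/2 - M) / 2) (C * (d - c) / exp (2 * C * N))"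
  have \<delta>: "0 < \<delta>" "\<delta> < m + 1/2 - M" "\<delta> \<le> C * (d - c) / exp (2 * C * N)"
    using assms C(1) cd by (auto simp: \<delta>_def min_def)
  from \<delta>(3) have "exp (2 * C * N) * \<delta> \<le> C * (d - c)"
    by (simp add: pos_le_divide_eq mult.commute)
  then have "exp (2 * C * N) \<le> C * (d - c) / \<delta>"
    using \<delta>(1) by (simp only: pos_le_divide_eq)
  then have less: "exp (2 * C * N) < 1 + C * (d - c) / \<delta>" by simp
  then have "ln (exp (2 * C * N)) < ln (1 + C * (d - c) / \<delta>)"
    using less_trans[OF exp_gt_zero less] by (simp only: ln_less_cancel_iff exp_gt_zero)
  then have "N < ln (1 + C * (d - c) / \<delta>) / (2 * C)"
    using C(1) by (simp add: pos_less_divide_eq mult.commute mult.left_commute)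
  also have "\<dots> \<le> slow_time (M + \<delta>)"
    using slow_time_ge_log[OF C(1) cd C(3), of "M + \<delta>"] \<delta> by simp
  finally show thesis using that[of "M + \<delta>"] \<delta> by simp
qed

section \<open>Solutions with small slope\<close>

text \<open>A solution takes every value in \<open>[up, um]\<close>, so bounds for \<open>f\<close> along it hold for the extreme
  values \<open>m\<close> and \<open>M\<close>; this turns slope bounds into bounds for \<open>K\<close>.\<close>

lemma level_extremes:
  assumes "solves v" "\<And>x. x \<in> {-l..l} \<Longrightarrow> P (f (v x))"
  shows "P m" "P M"
  using solution_range[OF assms(1)] m_attained M_attained assms(2)
  by (metis imageE)+

lemma dx_closure:
  assumes "solves v" "closed I" "\<And>x. x \<in> {-l<..<l} \<Longrightarrow> dx l v x \<in> I" "x \<in> {-l..l}"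
  shows "dx l v x \<in> I"
proof -
  have "dx l v ` closure {-l<..<l} \<subseteq> I"
    using solution_regular(3)[OF assms(1)] assms(2,3) l_pos
    by (intro image_closure_subset) auto
  then show ?thesis using assms(4) l_pos by auto
qed

lemma slow_solution_time:
  assumes "solves v" "M < K" "K \<le> m + 1/2"
    and "\<And>x. x \<in> {-l..l} \<Longrightarrow> - \<epsilon> * dx l v x = Q_inv (K - f (v x))"
  shows "slow_time K = 2 * l / \<epsilon>" "\<And>x. x \<in> {-l..l} \<Longrightarrow> 1 / Q_inv (K - f (v x)) * dx l v x = - 1 / \<epsilon>"
proof -
  show *: "1 / Q_inv (K - f (v x)) * dx l v x = - 1 / \<epsilon>" if "x \<in> {-l..l}" for x
  proof -
    have "v x \<in> {up..um}" using solution_range[OF assms(1)] that by blast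
    then have "0 < Q_inv (K - f (v x))" using assms by (intro fast_integrand_pos) auto
    then show ?thesis using assms(4)[OF that] \<epsilon>_pos by (simp add: field_simps)
  qed
  show "slow_time K = 2 * l / \<epsilon>"
    unfolding slow_time_def
    by (rule solution_time[OF continuous_on_slow_integrand assms(1) *]) (use assms in auto)
qed

lemma slow_solution_level:
  assumes "solves v" "small_slope \<epsilon> l {-l<..<l} v"
  obtains K where "M \<le> K" "K \<le> m + 1/2"
    "\<And>x. x \<in> {-l..l} \<Longrightarrow> - \<epsilon> * dx l v x = Q_inv (K - f (v x))"
    "\<And>x. x \<in> {-l..l} \<Longrightarrow> Q (- \<epsilon> * dx l v x) = K - f (v x)"
proof -
  obtain K where K: "\<And>x. x \<in> {-l..l} \<Longrightarrow> Q (- \<epsilon> * dx l v x) = K - f (v x)"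
    using first_integral[OF assms(1)] by blast
  have slope: "0 \<le> - \<epsilon> * dx l v x" "- \<epsilon> * dx l v x \<le> 1" if "x \<in> {-l..l}" for x
  proof -
    have "dx l v x \<in> {- (1 / \<epsilon>)..0}"
      using assms(2) by (intro dx_closure[OF assms(1) _ _ that]) (auto simp: small_slope_def less_imp_le)
    then show "0 \<le> - \<epsilon> * dx l v x" "- \<epsilon> * dx l v x \<le> 1"
      using \<epsilon>_pos by (auto simp: field_simps mult_nonneg_nonpos)
  qed
  have "0 \<le> K - f (v x) \<and> K - f (v x) \<le> 1/2" if "x \<in> {-l..l}" for x
    using Q_bounds[OF slope(1)[OF that]] K[OF that] by simp
  from level_extremes[OF assms(1), of "\<lambda>y. 0 \<le> K - y \<and> K - y \<le> 1/2", OF this]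
  have "M \<le> K" "K \<le> m + 1/2" by auto
  moreover have "- \<epsilon> * dx l v x = Q_inv (K - f (v x))" if "x \<in> {-l..l}" for x
    using Q_inv_Q[OF slope[OF that]] K[OF that] by simp
  ultimately show thesis using that K by blast
qed

lemma slow_closed_solution:
  assumes "solves v" "small_slope \<epsilon> l {-l..l} v"
  obtains K where "M < K" "K < m + 1/2" "slow_time K = 2 * l / \<epsilon>"
proof -
  have "small_slope \<epsilon> l {-l<..<l} v" using assms(2) by (auto simp: small_slope_def)
  then obtain K where K: "M \<le> K" "K \<le> m + 1/2"
    "\<And>x. x \<in> {-l..l} \<Longrightarrow> - \<epsilon> * dx l v x = Q_inv (K - f (v x))"
    "\<And>x. x \<in> {-l..l} \<Longrightarrow> Q (- \<epsilon> * dx l v x) = K - f (v x)"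
    using slow_solution_level[OF assms(1)] by blast
  have "0 < K - f (v x) \<and> K - f (v x) < 1/2" if "x \<in> {-l..l}" for x
  proof -
    have "0 < - \<epsilon> * dx l v x" "- \<epsilon> * dx l v x < 1"
      using assms(2) that \<epsilon>_pos by (auto simp: small_slope_def field_simps mult_pos_neg)
    then show ?thesis
      using Q_pos[of "- \<epsilon> * dx l v x"] Q_less_half[of "- \<epsilon> * dx l v x"] K(4)[OF that] by auto
  qed
  from level_extremes[OF assms(1), of "\<lambda>y. 0 < K - y \<and> K - y < 1/2", OF this]
  have "M < K" "K < m + 1/2" by auto
  then show thesis using that slow_solution_time(1)[OF assms(1) _ _ K(3)] by auto
qed

text \<open>The slope bounds in the open interval leave \<open>M \<le> K \<le> m + 1/2\<close>. Both end points are excluded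
  through the travel time: \<open>K = m + 1/2\<close> gives exactly \<open>B_int\<close>, and for \<open>K = M\<close> the solution moves
  at most as fast as the equation at any higher level \<open>K'\<close>, although these travel times are
  unbounded.\<close>

lemma slow_open_solution:
  assumes "M - m < 1/2" "B_int f m um up < 2 * l / \<epsilon>"
    and "solves v" "small_slope \<epsilon> l {-l<..<l} v"
  obtains K where "M < K" "K < m + 1/2" "slow_time K = 2 * l / \<epsilon>"
    "\<And>x. x \<in> {-l..l} \<Longrightarrow> 1 / Q_inv (K - f (v x)) * dx l v x = - 1 / \<epsilon>"
proof -
  obtain K where K: "M \<le> K" "K \<le> m + 1/2"
    "\<And>x. x \<in> {-l..l} \<Longrightarrow> - \<epsilon> * dx l v x = Q_inv (K - f (v x))"
    "\<And>x. x \<in> {-l..l} \<Longrightarrow> Q (- \<epsilon> * dx l v x) = K - f (v x)"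
    using slow_solution_level[OF assms(3,4)] by blast
  have in_range: "v x \<in> {up..um}" if "x \<in> {-l..l}" for x
    using solution_range[OF assms(3)] that by blast
  have "K \<noteq> M"
  proof
    assume "K = M"
    obtain K' where K': "M < K'" "K' < m + 1/2" "2 * l / \<epsilon> < slow_time K'"
      using slow_time_unbounded[OF assms(1)] by blast
    have "slow_time K' \<le> 2 * l / \<epsilon>"
      unfolding slow_time_def
    proof (rule travel_time_le[OF _ \<epsilon>_pos l_pos in_range, where v' = "dx l v"])
      show "continuous_on {up..um} (\<lambda>s. 1 / Q_inv (K' - f s))"
        using K' by (intro continuous_on_slow_integrand) auto
      fix x assume x: "x \<in> {-l..l}"
      have "- \<epsilon> * dx l v x \<le> Q_inv (K' - f (v x))"
        unfolding K(3)[OF x] \<open>K = M\<close>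
        using level_bounds[OF in_range[OF x], of M] level_bounds[OF in_range[OF x], of K'] K'
        by (intro Q_inv_mono) auto
      moreover have "0 < Q_inv (K' - f (v x))"
        using K' in_range[OF x] by (intro fast_integrand_pos) auto
      ultimately show "- 1 / \<epsilon> \<le> 1 / Q_inv (K' - f (v x)) * dx l v x"
        using \<epsilon>_pos by (simp add: field_simps)
    qed (use assms(3) solution_regular(1)[OF assms(3)] in \<open>auto simp: decreasing_solution_def\<close>)
    with K'(3) show False by simp
  qed
  with K have "M < K" by simp
  note time = slow_solution_time[OF assms(3) this K(2,3)]
  have "K \<noteq> m + 1/2" using time(1) assms(2) slow_time_top by auto
  then show thesis using that \<open>M < K\<close> K(2) time by auto
qed

lemma slow_solution_unique:
  assumes "M - m < 1/2" "B_int f m um up < 2 * l / \<epsilon>"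
    and "solves v" "small_slope \<epsilon> l {-l<..<l} v"
    and "solves w" "small_slope \<epsilon> l {-l<..<l} w"
  shows "v = w"
proof -
  obtain K where K: "M < K" "K < m + 1/2" "slow_time K = 2 * l / \<epsilon>"
    "\<And>x. x \<in> {-l..l} \<Longrightarrow> 1 / Q_inv (K - f (v x)) * dx l v x = - 1 / \<epsilon>"
    using slow_open_solution[OF assms(1-4)] by blast
  obtain K' where K': "M < K'" "K' < m + 1/2" "slow_time K' = 2 * l / \<epsilon>"
    "\<And>x. x \<in> {-l..l} \<Longrightarrow> 1 / Q_inv (K' - f (w x)) * dx l w x = - 1 / \<epsilon>"
    using slow_open_solution[OF assms(1,2,5,6)] by blast
  have "K = K'"
    using slow_time_strict_antimono[of K K'] slow_time_strict_antimono[of K' K] K K'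
    by (cases K K' rule: linorder_cases) auto
  show ?thesis
    using K K' fast_integrand_pos[of K] assms(3,5) unfolding \<open>K = K'\<close>
    by (intro travel_time_unique[of "\<lambda>s. 1 / Q_inv (K' - f s)"] continuous_on_slow_integrand) auto
qed

lemma slow_solution_exists:
  assumes "M - m < 1/2" "B_int f m um up < 2 * l / \<epsilon>"
  obtains v where "solves v" "small_slope \<epsilon> l {-l..l} v"
proof -
  obtain K1 where K1: "M < K1" "K1 < m + 1/2" "2 * l / \<epsilon> < slow_time K1"
    using slow_time_unbounded[OF assms(1)] by blast
  have "continuous_on {K1..m + 1/2} slow_time"
    using K1 by (intro continuous_on_subset[OF continuous_on_slow_time]) auto
  from IVT2'[OF _ _ _ this, of "2 * l / \<epsilon>"]
  obtain K where K: "K1 \<le> K" "K \<le> m + 1/2" "slow_time K = 2 * l / \<epsilon>"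
    using K1 assms(2) slow_time_top by auto
  have "K \<noteq> m + 1/2" using K(3) assms(2) slow_time_top by auto
  then have "M < K" "K < m + 1/2" using K K1 by auto
  obtain d where d: "\<And>y. 0 < y \<Longrightarrow> y < 1/2 \<Longrightarrow> (Q_inv has_real_derivative d y) (at y)"
    "continuous_on {0<..<1/2} d"
    by (rule Q_inv_C1) blast
  have "0 < Q_inv y \<and> Q (Q_inv y) = y" if "0 < y" "y < 1/2" for y
    using that by (auto simp: Q_inv_pos Q_Q_inv)
  then obtain v where v: "solves v" "\<And>x. x \<in> {-l..l} \<Longrightarrow>
      0 < K - f (v x) \<and> K - f (v x) < 1/2 \<and> dx l v x = - Q_inv (K - f (v x)) / \<epsilon>"
    using solution_exists[OF \<open>M < K\<close> \<open>K < m + 1/2\<close> _ d] K(3)[unfolded slow_time_def] by blast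
  have "small_slope \<epsilon> l {-l..l} v"
    unfolding small_slope_def
  proof
    fix x assume x: "x \<in> {-l..l}"
    have "0 < Q_inv (K - f (v x))" "Q_inv (K - f (v x)) < 1"
      using v(2)[OF x] by (auto intro: Q_inv_pos Q_inv_less_1)
    then have "0 < Q_inv (K - f (v x)) / \<epsilon>" "Q_inv (K - f (v x)) / \<epsilon> < 1 / \<epsilon>"
      using \<epsilon>_pos by (simp_all add: divide_strict_right_mono)
    then show "- (1 / \<epsilon>) < dx l v x \<and> dx l v x < 0"
      using v(2)[OF x] by simp
  qed
  with v(1) show thesis using that by blast
qed

section \<open>Solutions with large slope\<close>

text \<open>The slope is bounded on the compact interval, so \<open>Q p\<close> stays strictly positive and
  \<open>M < K\<close> is automatic. Only the upper end point \<open>K = m + 1/2\<close> can occur when the slope bound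
  holds in the open interval alone.\<close>

lemma fast_solution_level:
  assumes "solves v" "large_slope \<epsilon> l {-l<..<l} v"
  obtains K where "M < K" "K \<le> m + 1/2" "fast_time K = 2 * l / \<epsilon>"
    "\<And>x. x \<in> {-l..l} \<Longrightarrow> Q_inv (K - f (v x)) * dx l v x = - 1 / \<epsilon>"
    "\<And>x. x \<in> {-l..l} \<Longrightarrow> Q (- \<epsilon> * dx l v x) = K - f (v x)"
proof -
  obtain K where K: "\<And>x. x \<in> {-l..l} \<Longrightarrow> Q (- \<epsilon> * dx l v x) = K - f (v x)"
    using first_integral[OF assms(1)] by blast
  have slope: "1 \<le> - \<epsilon> * dx l v x" if "x \<in> {-l..l}" for x
  proof -
    have "dx l v x \<in> {..- (1 / \<epsilon>)}"
      using assms(2) by (intro dx_closure[OF assms(1) _ _ that]) (auto simp: large_slope_def less_imp_le)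
    then show ?thesis
      using \<epsilon>_pos by (auto simp: field_simps)
  qed
  have "0 < K - f (v x) \<and> K - f (v x) \<le> 1/2" if "x \<in> {-l..l}" for x
    using Q_bounds[of "- \<epsilon> * dx l v x"] Q_pos[of "- \<epsilon> * dx l v x"] slope[OF that] K[OF that] by simp
  from level_extremes[OF assms(1), of "\<lambda>y. 0 < K - y \<and> K - y \<le> 1/2", OF this]
  have K_bounds: "M < K" "K \<le> m + 1/2" by auto
  have ode: "Q_inv (K - f (v x)) * dx l v x = - 1 / \<epsilon>" if "x \<in> {-l..l}" for x
    using Q_inv_Q_ge1[OF slope[OF that]] K[OF that] slope[OF that] \<epsilon>_pos
    by (auto simp: field_simps)
  have "fast_time K = 2 * l / \<epsilon>"
    unfolding fast_time_def
    by (rule solution_time[OF continuous_on_fast_integrand assms(1) ode]) (use K_bounds in auto)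
  then show thesis using that K_bounds ode K by blast
qed

lemma fast_closed_solution:
  assumes "solves v" "large_slope \<epsilon> l {-l..l} v"
  obtains K where "M < K" "K < m + 1/2" "fast_time K = 2 * l / \<epsilon>"
proof -
  have "large_slope \<epsilon> l {-l<..<l} v" using assms(2) by (auto simp: large_slope_def)
  then obtain K where K: "M < K" "K \<le> m + 1/2" "fast_time K = 2 * l / \<epsilon>"
    "\<And>x. x \<in> {-l..l} \<Longrightarrow> Q_inv (K - f (v x)) * dx l v x = - 1 / \<epsilon>"
    "\<And>x. x \<in> {-l..l} \<Longrightarrow> Q (- \<epsilon> * dx l v x) = K - f (v x)"
    using fast_solution_level[OF assms(1)] by blast
  have "K - f (v x) < 1/2" if "x \<in> {-l..l}" for x
  proof -
    have "1 < - \<epsilon> * dx l v x"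
      using assms(2) that \<epsilon>_pos by (auto simp: large_slope_def field_simps)
    then show ?thesis
      using Q_less_half[of "- \<epsilon> * dx l v x"] K(5)[OF that] by auto
  qed
  from level_extremes(1)[OF assms(1), of "\<lambda>y. K - y < 1/2", OF this]
  have "K < m + 1/2" by auto
  then show thesis using that K by auto
qed

lemma fast_solution_unique:
  assumes "solves v" "large_slope \<epsilon> l {-l<..<l} v"
    and "solves w" "large_slope \<epsilon> l {-l<..<l} w"
  shows "v = w"
proof -
  obtain K where K: "M < K" "K \<le> m + 1/2" "fast_time K = 2 * l / \<epsilon>"
    "\<And>x. x \<in> {-l..l} \<Longrightarrow> Q_inv (K - f (v x)) * dx l v x = - 1 / \<epsilon>"
    "\<And>x. x \<in> {-l..l} \<Longrightarrow> Q (- \<epsilon> * dx l v x) = K - f (v x)"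
    using fast_solution_level[OF assms(1,2)] by blast
  obtain K' where K': "M < K'" "K' \<le> m + 1/2" "fast_time K' = 2 * l / \<epsilon>"
    "\<And>x. x \<in> {-l..l} \<Longrightarrow> Q_inv (K' - f (w x)) * dx l w x = - 1 / \<epsilon>"
    "\<And>x. x \<in> {-l..l} \<Longrightarrow> Q (- \<epsilon> * dx l w x) = K' - f (w x)"
    using fast_solution_level[OF assms(3,4)] by blast
  have "K = K'"
    using fast_time_strict_mono[of K K'] fast_time_strict_mono[of K' K] K K'
    by (cases K K' rule: linorder_cases) auto
  show ?thesis
    using K K' fast_integrand_pos[of K] assms(1,3) unfolding \<open>K = K'\<close>
    by (intro travel_time_unique[of "\<lambda>s. Q_inv (K' - f s)"] continuous_on_fast_integrand) auto
qed

lemma fast_solution_exists: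
  assumes "M - m < 1/2" "L_minus f M um up < 2 * l / \<epsilon>" "2 * l / \<epsilon> < L_plus f m um up"
  obtains v where "solves v" "large_slope \<epsilon> l {-l..l} v"
proof -
  from IVT'[OF _ _ _ continuous_on_fast_time, of "2 * l / \<epsilon>"]
  obtain K where K: "M \<le> K" "K \<le> m + 1/2" "fast_time K = 2 * l / \<epsilon>"
    using assms fast_time_M fast_time_top by auto
  have "K \<noteq> M" "K \<noteq> m + 1/2"
    using K(3) assms fast_time_M fast_time_top by auto
  then have "M < K" "K < m + 1/2" using K by auto
  obtain d where d: "\<And>y. 0 < y \<Longrightarrow> y < 1/2 \<Longrightarrow> (Q_inv has_real_derivative d y) (at y)"
    "continuous_on {0<..<1/2} d"
    by (rule Q_inv_C1) blast
  have pos: "0 < Q_inv y" if "0 < y" "y < 1/2" for y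
    using that by (auto simp: Q_inv_pos)
  have r_deriv: "((\<lambda>y. 1 / Q_inv y) has_real_derivative - d y / (Q_inv y)\<^sup>2) (at y)"
    if "0 < y" "y < 1/2" for y
    using d(1)[OF that] pos[OF that] by (auto intro!: derivative_eq_intros simp: power2_eq_square)
  have r_cont: "continuous_on {0<..<1/2} (\<lambda>y. - d y / (Q_inv y)\<^sup>2)"
    using pos
    by (intro continuous_intros d(2) continuous_on_subset[OF continuous_on_Q_inv])
       (auto simp: less_imp_neq[symmetric])
  have r_inv: "0 < 1 / Q_inv y \<and> Q (1 / Q_inv y) = y" if "0 < y" "y < 1/2" for y
    using that pos[OF that] by (simp add: Q_inverse Q_Q_inv)
  have time: "integral {up..um} (\<lambda>s. 1 / (1 / Q_inv (K - f s))) = 2 * l / \<epsilon>"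
    using K(3) by (simp add: fast_time_def)
  obtain v where v: "solves v" "\<And>x. x \<in> {-l..l} \<Longrightarrow>
      0 < K - f (v x) \<and> K - f (v x) < 1/2 \<and> dx l v x = - (1 / Q_inv (K - f (v x))) / \<epsilon>"
    using solution_exists[OF \<open>M < K\<close> \<open>K < m + 1/2\<close> r_inv r_deriv r_cont time] by blast
  have "large_slope \<epsilon> l {-l..l} v"
    unfolding large_slope_def
  proof
    fix x assume x: "x \<in> {-l..l}"
    have "0 < Q_inv (K - f (v x))" "Q_inv (K - f (v x)) < 1"
      using v(2)[OF x] by (auto intro: Q_inv_pos Q_inv_less_1)
    then have "1 / \<epsilon> < 1 / Q_inv (K - f (v x)) / \<epsilon>"
      using \<epsilon>_pos by (intro divide_strict_right_mono) auto
    then show "dx l v x < - (1 / \<epsilon>)"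
      using v(2)[OF x] by simp
  qed
  with v(1) show thesis using that by blast
qed

end

section \<open>The solvability conditions\<close>

theorem proposition2p3:
  fixes f :: "real \<Rightarrow> real" and \<epsilon> l um up m M :: real
  assumes "\<epsilon> > 0" and "l > 0"
    and "C2_on UNIV f"
    and "um > up"
    and "m \<in> f ` {up..um}" and "\<forall>u\<in>{up..um}. m \<le> f u"
    and "M \<in> f ` {up..um}" and "\<forall>u\<in>{up..um}. f u \<le> M"
  shows
    "((\<exists>!v. decreasing_solution \<epsilon> l f um up v \<and> small_slope \<epsilon> l {-l..l} v)
        \<longleftrightarrow> M - m < 1/2 \<and> 2 * l / \<epsilon> > B_int f m um up) \<and>
     (M - m < 1/2 \<and> 2 * l / \<epsilon> > B_int f m um up \<longrightarrow>
        (\<exists>!v. decreasing_solution \<epsilon> l f um up v \<and> small_slope \<epsilon> l {-l<..<l} v)) \<and>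
     ((\<exists>!v. decreasing_solution \<epsilon> l f um up v \<and> large_slope \<epsilon> l {-l..l} v)
        \<longleftrightarrow> M - m < 1/2 \<and> L_minus f M um up < 2 * l / \<epsilon> \<and> 2 * l / \<epsilon> < L_plus f m um up) \<and>
     (M - m < 1/2 \<and> L_minus f M um up < 2 * l / \<epsilon> \<and> 2 * l / \<epsilon> < L_plus f m um up \<longrightarrow>
        (\<exists>!v. decreasing_solution \<epsilon> l f um up v \<and> large_slope \<epsilon> l {-l<..<l} v))"
proof -
  interpret viscous_bvp f \<epsilon> l um up m M
    by unfold_locales (use assms in auto)
  have small_open: "small_slope \<epsilon> l {-l..l} v \<Longrightarrow> small_slope \<epsilon> l {-l<..<l} v"
    and large_open: "large_slope \<epsilon> l {-l..l} v \<Longrightarrow> large_slope \<epsilon> l {-l<..<l} v" for v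
    by (auto simp: small_slope_def large_slope_def)
  have slow_necessary: "M - m < 1/2 \<and> B_int f m um up < 2 * l / \<epsilon>"
    if v: "solves v" "small_slope \<epsilon> l {-l..l} v" for v
  proof -
    obtain K where K: "M < K" "K < m + 1/2" "slow_time K = 2 * l / \<epsilon>"
      using slow_closed_solution[OF v] by blast
    then show ?thesis
      using slow_time_strict_antimono[of K "m + 1/2"] slow_time_top by auto
  qed
  have fast_necessary: "M - m < 1/2 \<and> L_minus f M um up < 2 * l / \<epsilon> \<and> 2 * l / \<epsilon> < L_plus f m um up"
    if v: "solves v" "large_slope \<epsilon> l {-l..l} v" for v
  proof -
    obtain K where K: "M < K" "K < m + 1/2" "fast_time K = 2 * l / \<epsilon>"
      using fast_closed_solution[OF v] by blast
    then show ?thesis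
      using fast_time_strict_mono[of K "m + 1/2"] fast_time_strict_mono[of M K]
        fast_time_top fast_time_M by auto
  qed
  have slow: "(\<exists>!v. solves v \<and> small_slope \<epsilon> l {-l..l} v) \<and>
      (\<exists>!v. solves v \<and> small_slope \<epsilon> l {-l<..<l} v)"
    if c: "M - m < 1/2" "B_int f m um up < 2 * l / \<epsilon>"
  proof -
    obtain v where v: "solves v" "small_slope \<epsilon> l {-l..l} v"
      using slow_solution_exists[OF c] by blast
    have "w = v" if "solves w" "small_slope \<epsilon> l {-l<..<l} w" for w
      using slow_solution_unique[OF c that v(1) small_open[OF v(2)]] .
    with v small_open show ?thesis by blast
  qed
  have fast: "(\<exists>!v. solves v \<and> large_slope \<epsilon> l {-l..l} v) \<and>
      (\<exists>!v. solves v \<and> large_slope \<epsilon> l {-l<..<l} v)"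
    if c: "M - m < 1/2" "L_minus f M um up < 2 * l / \<epsilon>" "2 * l / \<epsilon> < L_plus f m um up"
  proof -
    obtain v where v: "solves v" "large_slope \<epsilon> l {-l..l} v"
      using fast_solution_exists[OF c] by blast
    have "w = v" if "solves w" "large_slope \<epsilon> l {-l<..<l} w" for w
      using fast_solution_unique[OF that v(1) large_open[OF v(2)]] .
    with v large_open show ?thesis by blast
  qed
  have slow_iff: "(\<exists>!v. solves v \<and> small_slope \<epsilon> l {-l..l} v)
      \<longleftrightarrow> M - m < 1/2 \<and> B_int f m um up < 2 * l / \<epsilon>"
  proof
    assume "\<exists>!v. solves v \<and> small_slope \<epsilon> l {-l..l} v"
    then obtain v where "solves v" "small_slope \<epsilon> l {-l..l} v" by (elim ex1E conjE)
    then show "M - m < 1/2 \<and> B_int f m um up < 2 * l / \<epsilon>"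
      by (rule slow_necessary)
  next
    assume "M - m < 1/2 \<and> B_int f m um up < 2 * l / \<epsilon>"
    then show "\<exists>!v. solves v \<and> small_slope \<epsilon> l {-l..l} v"
      by (elim conjE) (rule slow[THEN conjunct1])
  qed
  have fast_iff: "(\<exists>!v. solves v \<and> large_slope \<epsilon> l {-l..l} v)
      \<longleftrightarrow> M - m < 1/2 \<and> L_minus f M um up < 2 * l / \<epsilon> \<and> 2 * l / \<epsilon> < L_plus f m um up"
  proof
    assume "\<exists>!v. solves v \<and> large_slope \<epsilon> l {-l..l} v"
    then obtain v where "solves v" "large_slope \<epsilon> l {-l..l} v" by (elim ex1E conjE)
    then show "M - m < 1/2 \<and> L_minus f M um up < 2 * l / \<epsilon> \<and> 2 * l / \<epsilon> < L_plus f m um up"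
      by (rule fast_necessary)
  next
    assume "M - m < 1/2 \<and> L_minus f M um up < 2 * l / \<epsilon> \<and> 2 * l / \<epsilon> < L_plus f m um up"
    then show "\<exists>!v. solves v \<and> large_slope \<epsilon> l {-l..l} v"
      by (elim conjE) (rule fast[THEN conjunct1])
  qed
  show ?thesis
    using slow_iff fast_iff slow[THEN conjunct2] fast[THEN conjunct2] by blast
qed

end
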